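(* Let $n$ be an integer, let $S$ be a set of $2n+1$ points in general position in the Euclidean plane, and let $a<b$ be two non-negative integers such that $a+b=2n-2$. Then there are exactly $2(a+1)(b+1)$ circles which are either $(a,b)$-splitting or $(b,a)$-splitting for $S$.
   Context: A finite set $S$ of points in the Euclidean plane is in general position if no three points of $S$ are collinear and no four points of $S$ are concyclic (lie on a common circle). For a set $S$ of $2n+1$ points in general position and non-negative integers $a,b$ with $a+b=2n-2$, a circle passing through three points of $S$ is called $(a,b)$-splitting for $S$ if it has exactly $a$ points of $S$ in its interior (the open disk it bounds) and the remaining $b$ points of $S$ in its exterior. *)

theory Defs
  imports "HOL-Analysis.Analysis"
begin

(* A circle is a set of points; the positive radius rules out single points and the empty set. *)
definition circle :: "(real^2) set \<Rightarrow> bool" where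
  "circle C \<longleftrightarrow> (\<exists>c r. r > 0 \<and> C = sphere c r)"

definition concyclic :: "(real^2) set \<Rightarrow> bool" where
  "concyclic T \<longleftrightarrow> (\<exists>C. circle C \<and> T \<subseteq> C)"

definition general_position :: "(real^2) set \<Rightarrow> bool" where
  "general_position S \<longleftrightarrow> finite S \<and>
     (\<forall>T\<subseteq>S. card T = 3 \<longrightarrow> \<not> collinear T) \<and>
     (\<forall>T\<subseteq>S. card T = 4 \<longrightarrow> \<not> concyclic T)"

(* Centre and radius are determined by the circle C, so ball c r is its interior and the
   complement of cball c r its exterior. For card S = a + b + 3 the points of T are the only
   points of S on C. *)
definition splitting :: "nat \<Rightarrow> nat \<Rightarrow> (real^2) set \<Rightarrow> (real^2) set \<Rightarrow> bool" where
  "splitting a b S C \<longleftrightarrow> (\<exists>c r. r > 0 \<and> C = sphere c r \<and>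
     (\<exists>T\<subseteq>S. card T = 3 \<and> T \<subseteq> C) \<and>
     card (S \<inter> ball c r) = a \<and>
     card (S - cball c r) = b)"

end

theory Submission
  imports Defs
begin

text \<open>
  Why the count depends on nothing but \<open>a\<close> and \<open>b\<close>: every triple \<open>T\<close> of points of \<open>S\<close> spans one
  circle, which has two sides, its open disc and its exterior. Let \<open>E i\<close> be the number of sides, over
  all triples, that contain exactly \<open>i\<close> points of \<open>S\<close>. The two sides of a triple together contain
  \<open>a + b\<close> points, and \<open>a \<noteq> b\<close>, so the required number is \<open>E a\<close>. It turns out that all the numbers
  \<open>E i\<close> are forced, because their binomial moments are.

  The moment \<open>\<Sum>i. E i * (i choose k)\<close> counts a side together with \<open>k\<close> points chosen on it. Grouping by
  the set \<open>U\<close> made up of the triple and the chosen points, it counts for every \<open>U \<subseteq> S\<close> with \<open>k + 3\<close>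
  elements the sides of triples of \<open>U\<close> that avoid \<open>U\<close> (always the side opposite to the chosen
  points). On the paraboloid these are the facets of a simplicial polytope with \<open>card U\<close> vertices, so
  there are \<open>2 * (card U - 2)\<close> of them (\<open>card_empty_circles\<close>). Hence the moment is
  \<open>2 * (k + 1) * (card S choose (k + 3))\<close>, and this triangular system of equations has the single
  solution \<open>E i = 2 * (i + 1) * (card S - 2 - i)\<close> (\<open>counts_from_binomial_moments\<close>).

  The count of empty sides is local. Choose a direction \<open>e\<close> that orders the points of \<open>U\<close> without
  ties; every triple then has a middle vertex. If \<open>v\<close> is neither the first nor the last point,
  exactly two empty sides belong to triples with middle vertex \<open>v\<close>
  (\<open>two_empty_circles_with_middle\<close>). Indeed, an inversion at \<open>v\<close> turns circles through \<open>v\<close> into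
  lines and keeps the two sides of the line through \<open>v\<close> orthogonal to \<open>e\<close> apart. A triple with middle
  vertex \<open>v\<close> becomes a pair of points on different sides of that line, and an empty side of its circle
  becomes an empty half plane bounded by the line through the pair. Such a half plane belongs to the
  upper or to the lower bridge between the two parts, each of which is unique (\<open>unique_bridge\<close>).
\<close>

section \<open>Numbers determined by their binomial moments\<close>

text \<open>Raising \<open>m\<close> by one adds a full column sum of Pascal's triangle, which the hockey-stick identity
  evaluates; Pascal's rule then closes the induction.\<close>

lemma sum_weighted_choose:
  "(\<Sum>i\<le>m. (m + 1 - i) * (Suc i choose Suc k)) = (m + 3 choose (k + 3))"
proof (induction m)
  case 0
  show ?case by (cases k) (auto simp: numeral_eq_Suc)
next
  case (Suc m)
  have "(\<Sum>i\<le>Suc m. (Suc m + 1 - i) * (Suc i choose Suc k))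
      = (\<Sum>i\<le>Suc m. ((m + 1 - i) * (Suc i choose Suc k) + (Suc i choose Suc k)))"
    by (rule sum.cong) (auto simp: Suc_diff_le)
  also have "\<dots> = (\<Sum>i\<le>m. (m + 1 - i) * (Suc i choose Suc k)) + (\<Sum>i\<le>Suc m. (Suc i choose Suc k))"
    by (simp add: sum.distrib)
  also have "(\<Sum>i\<le>Suc m. (Suc i choose Suc k)) = (m + 3 choose (k + 2))"
  proof -
    have "(\<Sum>i\<le>Suc m. (Suc i choose Suc k)) = (\<Sum>i\<le>Suc (Suc m). (i choose Suc k))"
      by (simp only: sum.atMost_Suc_shift[of "\<lambda>i. i choose Suc k" "Suc m"]) simp
    also have "\<dots> = (m + 3 choose (k + 2))"
      using sum_choose_upper[of "Suc k" "Suc (Suc m)"] by (simp add: numeral_eq_Suc)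
    finally show ?thesis .
  qed
  finally have "(\<Sum>i\<le>Suc m. (Suc m + 1 - i) * (Suc i choose Suc k))
      = (m + 3 choose (k + 3)) + (m + 3 choose (k + 2))"
    using Suc by simp
  moreover have "Suc m + 3 choose (k + 3) = (m + 3 choose (k + 2)) + (m + 3 choose (k + 3))"
    using binomial_Suc_Suc[of "m + 3" "k + 2"] by (simp add: eval_nat_numeral)
  ultimately show ?case by simp
qed

text \<open>The matrix of the numbers \<open>i choose k\<close> is triangular with ones on the diagonal: the \<open>j\<close>-th moment
  involves only the values at \<open>j\<close> and above, so these are recovered from the top down.\<close>

lemma binomial_moments_determine:
  fixes E F :: "nat \<Rightarrow> nat"
  assumes "\<And>k. k \<le> m \<Longrightarrow> (\<Sum>i\<le>m. E i * (i choose k)) = (\<Sum>i\<le>m. F i * (i choose k))"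
    and "j \<le> m"
  shows "E j = F j"
  using assms(2)
proof (induction "m - j" arbitrary: j rule: less_induct)
  case less
  have split: "(\<Sum>i\<le>m. G i * (i choose j)) = G j + (\<Sum>i\<in>{Suc j..m}. G i * (i choose j))"
    for G :: "nat \<Rightarrow> nat"
  proof -
    have "(\<Sum>i\<le>m. G i * (i choose j)) = (\<Sum>i\<in>{j..m}. G i * (i choose j))"
      by (rule sum.mono_neutral_right) auto
    also have "\<dots> = G j + (\<Sum>i\<in>{Suc j..m}. G i * (i choose j))"
      using less.prems by (subst sum.atLeast_Suc_atMost) auto
    finally show ?thesis .
  qed
  have "(\<Sum>i\<in>{Suc j..m}. E i * (i choose j)) = (\<Sum>i\<in>{Suc j..m}. F i * (i choose j))"
    by (rule sum.cong) (auto intro!: less.hyps)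
  then show ?case using assms(1)[OF less.prems] split[of E] split[of F] by simp
qed

text \<open>The claimed solution has the right moments because \<open>(i + 1) * (i choose k)\<close> equals
  \<open>(k + 1) * (Suc i choose Suc k)\<close>, which turns its \<open>k\<close>-th moment into the sum of
  \<open>sum_weighted_choose\<close>.\<close>

lemma counts_from_binomial_moments:
  fixes E :: "nat \<Rightarrow> nat"
  assumes "\<And>k. k \<le> m \<Longrightarrow> (\<Sum>i\<le>m. E i * (i choose k)) = 2 * (k + 1) * (m + 3 choose (k + 3))"
    and "j \<le> m"
  shows "E j = 2 * (j + 1) * (m + 1 - j)"
proof (rule binomial_moments_determine[OF _ assms(2)])
  fix k assume k: "k \<le> m"
  have "(\<Sum>i\<le>m. 2 * (i + 1) * (m + 1 - i) * (i choose k))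
      = (\<Sum>i\<le>m. 2 * (k + 1) * ((m + 1 - i) * (Suc i choose Suc k)))"
  proof (rule sum.cong)
    fix i
    have "(i + 1) * (i choose k) = (k + 1) * (Suc i choose Suc k)"
      using Suc_times_binomial[of k i] by simp
    then show "2 * (i + 1) * (m + 1 - i) * (i choose k) = 2 * (k + 1) * ((m + 1 - i) * (Suc i choose Suc k))"
      by (metis (no_types, lifting) mult.assoc mult.left_commute)
  qed simp
  also have "\<dots> = 2 * (k + 1) * (m + 3 choose (k + 3))"
    by (simp only: sum_distrib_left[symmetric] sum_weighted_choose)
  finally show "(\<Sum>i\<le>m. E i * (i choose k)) = (\<Sum>i\<le>m. 2 * (i + 1) * (m + 1 - i) * (i choose k))"
    using assms(1)[OF k] by simp
qed

section \<open>Bridges between separated point sets\<close>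

text \<open>Read \<open>u\<close> and \<open>w\<close> as homogeneous coordinates in the plane: a point \<open>p\<close> of \<open>L\<close> stands for
  \<open>(-1, u p, w p)\<close> and a point \<open>q\<close> of \<open>R\<close> for \<open>(1, u q, w q)\<close>, with positive last coordinate, so the
  two sets lie on different sides of the vertical axis. The line through \<open>p\<close> and \<open>q\<close> meets this axis
  at height \<open>H p q\<close>, and the inequalities say that no point is above that line. A pair with maximal
  \<open>H\<close> has this property, since exchanging \<open>p\<close> or \<open>q\<close> for a point above the line would raise the
  crossing. Conversely, two pairs with the property bound each other's crossings, so both are at the
  same height; then both pairs lie on both lines, and by \<open>genL\<close> and \<open>genR\<close> they are equal.\<close>

lemma unique_bridge:
  fixes u w :: "'a \<Rightarrow> real"
  defines "H p q \<equiv> (u p + u q) / (w p + w q)"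
  assumes fin: "finite L" "finite R" and ne: "L \<noteq> {}" "R \<noteq> {}"
    and w: "\<And>p. p \<in> L \<union> R \<Longrightarrow> w p > 0"
    and genL: "\<And>p q r. p \<in> L \<Longrightarrow> q \<in> R \<Longrightarrow> r \<in> L \<Longrightarrow>
           u r - H p q * w r = u p - H p q * w p \<Longrightarrow> r = p"
    and genR: "\<And>p q r. p \<in> L \<Longrightarrow> q \<in> R \<Longrightarrow> r \<in> R \<Longrightarrow>
           u r - H p q * w r = u q - H p q * w q \<Longrightarrow> r = q"
  shows "card {(p, q) \<in> L \<times> R. (\<forall>r\<in>L. u r - H p q * w r \<le> u p - H p q * w p) \<and>
                               (\<forall>r\<in>R. u r - H p q * w r \<le> u q - H p q * w q)} = 1"
    (is "card ?B = 1")
proof -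
  \<comment> \<open>The residuals \<open>u r - H p q * w r\<close> at \<open>p\<close> and at \<open>q\<close> are opposite,
    as the line passes through both.\<close>
  have bal: "u p - H p q * w p + (u q - H p q * w q) = 0" if "p \<in> L" "q \<in> R" for p q
  proof -
    have "w p + w q > 0" using w[of p] w[of q] that by simp
    then have "H p q * (w p + w q) = u p + u q" by (simp add: H_def)
    then show ?thesis by (simp add: algebra_simps)
  qed
  have le: "u p' - h * w p' + (u q' - h * w q') \<le> 0 \<longleftrightarrow> H p' q' \<le> h"
    if "p' \<in> L" "q' \<in> R" for p' q' h
  proof -
    have "w p' + w q' > 0" using w[of p'] w[of q'] that by simp
    then have "H p' q' \<le> h \<longleftrightarrow> u p' + u q' \<le> h * (w p' + w q')"
      by (simp add: H_def divide_le_eq)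
    then show ?thesis by (auto simp: algebra_simps)
  qed
  define M where "M = Max ((\<lambda>(p, q). H p q) ` (L \<times> R))"
  have "M \<in> (\<lambda>(p, q). H p q) ` (L \<times> R)"
    unfolding M_def using fin ne by (intro Max_in) auto
  then obtain p q where pq: "p \<in> L" "q \<in> R" "M = H p q" by auto
  have max: "H p' q' \<le> H p q" if "p' \<in> L" "q' \<in> R" for p' q'
    unfolding pq(3)[symmetric] M_def using fin that by (intro Max_ge) auto
  have pq_in: "(p, q) \<in> ?B"
  proof -
    have "u r - H p q * w r \<le> u p - H p q * w p" if "r \<in> L" for r
      using le[OF that pq(2), of "H p q"] max[OF that pq(2)] bal[OF pq(1,2)] by linarith
    moreover have "u r - H p q * w r \<le> u q - H p q * w q" if "r \<in> R" for r
      using le[OF pq(1) that, of "H p q"] max[OF pq(1) that] bal[OF pq(1,2)] by linarith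
    ultimately show ?thesis using pq by simp
  qed
  have uniq: "p1 = p2 \<and> q1 = q2" if "(p1, q1) \<in> ?B" "(p2, q2) \<in> ?B" for p1 q1 p2 q2
  proof -
    have in1: "p1 \<in> L" "q1 \<in> R" and in2: "p2 \<in> L" "q2 \<in> R" using that by auto
    have ineq: "u p2 - H p1 q1 * w p2 \<le> u p1 - H p1 q1 * w p1"
         "u q2 - H p1 q1 * w q2 \<le> u q1 - H p1 q1 * w q1"
         "u p1 - H p2 q2 * w p1 \<le> u p2 - H p2 q2 * w p2"
         "u q1 - H p2 q2 * w q1 \<le> u q2 - H p2 q2 * w q2"
      using that by auto
    have "H p2 q2 \<le> H p1 q1" using le[OF in2, of "H p1 q1"] bal[OF in1] ineq by linarith
    moreover have "H p1 q1 \<le> H p2 q2" using le[OF in1, of "H p2 q2"] bal[OF in2] ineq by linarith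
    ultimately have eq: "H p1 q1 = H p2 q2" by simp
    have "u p2 - H p1 q1 * w p2 = u p1 - H p1 q1 * w p1"
         "u q2 - H p1 q1 * w q2 = u q1 - H p1 q1 * w q1"
      using bal[OF in1] bal[OF in2] ineq unfolding eq by linarith+
    then show ?thesis using genL[OF in1 in2(1)] genR[OF in1 in2(2)] by auto
  qed
  have "x = (p, q)" if "x \<in> ?B" for x
    using that uniq[OF _ pq_in, of "fst x" "snd x"] by (simp only: prod.collapse prod_eq_iff fst_conv snd_conv)
  then have "?B = {(p, q)}" using pq_in by blast
  then show ?thesis by simp
qed

section \<open>Circumcircles\<close>

lemma collinear_if_orthogonal:
  fixes l :: "real^2"
  assumes "l \<noteq> 0" and "\<And>z. z \<in> T \<Longrightarrow> l \<bullet> z = k"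
  shows "collinear T"
proof -
  have "aff_dim T \<le> aff_dim {z. l \<bullet> z = k}" using assms by (intro aff_dim_subset) auto
  then show ?thesis using assms(1) by (simp add: collinear_aff_dim aff_dim_hyperplane)
qed

text \<open>Subtracting the equations of the two circles leaves a linear equation that holds on \<open>T\<close>; it is
  trivial only if the centres coincide. A nontrivial one would make \<open>T\<close> collinear.\<close>

lemma circle_unique:
  fixes T :: "(real^2) set"
  assumes "\<not> collinear T" "T \<subseteq> sphere c r" "T \<subseteq> sphere c' r'"
  shows "c' = c \<and> r' = r"
proof -
  have eq: "2 * ((c' - c) \<bullet> z) = c' \<bullet> c' - r'\<^sup>2 - (c \<bullet> c - r\<^sup>2)" if "z \<in> T" for z
  proof -
    have "dist c z = r" "dist c' z = r'" using that assms by auto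
    then have "(c - z) \<bullet> (c - z) = r\<^sup>2" "(c' - z) \<bullet> (c' - z) = r'\<^sup>2"
      by (auto simp: dist_norm dot_square_norm)
    then show ?thesis by (simp add: algebra_simps inner_commute)
  qed
  have "c' = c"
  proof (rule ccontr)
    assume "c' \<noteq> c"
    then have "2 *\<^sub>R (c' - c) \<noteq> 0" by simp
    then show False using collinear_if_orthogonal[of "2 *\<^sub>R (c' - c)" T] eq assms(1)
      by (auto simp: inner_simps)
  qed
  moreover obtain z where "z \<in> T" using assms(1) collinear_empty[where ?'a = "real^2"] by (cases "T = {}") auto
  then have "dist c z = r" "dist c' z = r'" using assms(2,3) by auto
  ultimately show ?thesis by simp
qed

text \<open>The disc, exterior and circle of a set of points are defined by an existential quantifier over the
  circles through it, so that no circle has to be chosen; for three points that are not collinear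
  there is exactly one.\<close>

definition circumdisc :: "(real^2) set \<Rightarrow> (real^2) set" where
  "circumdisc T = {z. \<exists>c r. r > 0 \<and> T \<subseteq> sphere c r \<and> z \<in> ball c r}"

definition circumexterior :: "(real^2) set \<Rightarrow> (real^2) set" where
  "circumexterior T = {z. \<exists>c r. r > 0 \<and> T \<subseteq> sphere c r \<and> z \<notin> cball c r}"

definition circumcircle :: "(real^2) set \<Rightarrow> (real^2) set" where
  "circumcircle T = {z. \<exists>c r. r > 0 \<and> T \<subseteq> sphere c r \<and> z \<in> sphere c r}"

lemma circumcircle_eq:
  assumes "\<not> collinear T" "r > 0" "T \<subseteq> sphere c r"
  shows "circumdisc T = ball c r" "circumexterior T = - cball c r" "circumcircle T = sphere c r"
proof -
  have "(\<exists>c' r'. r' > 0 \<and> T \<subseteq> sphere c' r' \<and> P c' r') \<longleftrightarrow> P c r" for P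
    using circle_unique[OF assms(1,3)] assms(2,3) by metis
  then show "circumdisc T = ball c r" "circumexterior T = - cball c r" "circumcircle T = sphere c r"
    by (simp_all only: circumcircle_def circumdisc_def circumexterior_def Collect_mem_eq Compl_eq)
qed

text \<open>By completing the square, every equation \<open>l \<bullet> (z - v) = h * (norm (z - v))\<^sup>2\<close> with
  nonzero \<open>l\<close> and \<open>h\<close> describes a sphere
  through \<open>v\<close>, and the sign of the difference of its sides, together with that of \<open>h\<close>, tells the
  interior from the exterior. These equations are the images of affine equations under the
  inversion at \<open>v\<close>.\<close>

lemma pencil_circle:
  fixes v l :: "'a::euclidean_space"
  assumes "h \<noteq> 0" "l \<noteq> 0"
  obtains c r where "r > 0"
    "\<And>z. l \<bullet> (z - v) - h * ((z - v) \<bullet> (z - v)) = h * (r\<^sup>2 - (dist c z)\<^sup>2)"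
proof
  show "norm l / (2 * \<bar>h\<bar>) > 0" using assms by simp
  fix z
  have 1: "(norm l / (2 * \<bar>h\<bar>))\<^sup>2 = (l \<bullet> l) / (4 * h\<^sup>2)"
    by (simp add: power_divide power_mult_distrib dot_square_norm)
  have 2: "(dist (v + (1 / (2 * h)) *\<^sub>R l) z)\<^sup>2
      = (z - v) \<bullet> (z - v) - (1 / h) * (l \<bullet> (z - v)) + (l \<bullet> l) / (4 * h\<^sup>2)"
  proof -
    have "(dist (v + (1 / (2 * h)) *\<^sub>R l) z)\<^sup>2 = ((z - v) - (1 / (2 * h)) *\<^sub>R l) \<bullet> ((z - v) - (1 / (2 * h)) *\<^sub>R l)"
      by (simp add: dist_norm dot_square_norm norm_minus_commute diff_diff_eq)
    also have "\<dots> = (z - v) \<bullet> (z - v) - 2 * ((1 / (2 * h)) * (l \<bullet> (z - v))) + (1 / (2 * h)) * ((1 / (2 * h)) * (l \<bullet> l))"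
      by (simp only: inner_diff_left[of "z - v"] inner_diff_right[of _ "z - v"] inner_scaleR_left inner_scaleR_right inner_commute[of "z - v" l] right_diff_distrib)
    finally show ?thesis by (simp add: power2_eq_square)
  qed
  show "l \<bullet> (z - v) - h * ((z - v) \<bullet> (z - v))
      = h * ((norm l / (2 * \<bar>h\<bar>))\<^sup>2 - (dist (v + (1 / (2 * h)) *\<^sub>R l) z)\<^sup>2)"
    unfolding 1 2 using assms by (simp add: field_simps)
qed

text \<open>For \<open>T = {v, p, q}\<close> it suffices to find a circle of the pencil with \<open>h = 1\<close> at \<open>v\<close>: adding a
  multiple of a vector \<open>d\<close> orthogonal to \<open>p - v\<close> to the vector \<open>p - v\<close> keeps the equation for \<open>p\<close>,
  and one multiple solves the equation for \<open>q\<close> because \<open>d \<bullet> (q - v) \<noteq> 0\<close>.\<close>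

lemma circumcircle_exists:
  fixes T :: "(real^2) set"
  assumes "card T = 3" "\<not> collinear T"
  obtains c r where "r > 0" "T \<subseteq> sphere c r"
proof -
  obtain v p q where T: "T = {v, p, q}" "v \<noteq> p" using assms(1) by (auto simp: card_3_iff)
  obtain d :: "real^2" where d: "d \<noteq> 0" "orthogonal (p - v) d"
    using orthogonal_to_vector_exists[of "p - v"] by auto
  have "d \<bullet> (q - v) \<noteq> 0"
  proof
    assume "d \<bullet> (q - v) = 0"
    then have "d \<bullet> z = d \<bullet> v" if "z \<in> T" for z
      using that d(2) T(1) by (auto simp: orthogonal_def inner_diff_right inner_diff_left inner_commute)
    then show False using collinear_if_orthogonal[OF d(1)] assms(2) by blast
  qed
  define l where "l = (p - v) + (((q - v) \<bullet> (q - v) - (p - v) \<bullet> (q - v)) / (d \<bullet> (q - v))) *\<^sub>R d"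
  have lp: "l \<bullet> (p - v) = (p - v) \<bullet> (p - v)"
    using d(2) by (simp add: l_def inner_add_left orthogonal_def inner_commute[of d])
  have lq: "l \<bullet> (q - v) = (q - v) \<bullet> (q - v)"
    using \<open>d \<bullet> (q - v) \<noteq> 0\<close> by (simp add: l_def inner_add_left)
  have "l \<noteq> 0" using lp T(2) by auto
  from pencil_circle[OF one_neq_zero this, of v]
  obtain c r where r: "r > 0"
    and eq: "\<And>z. l \<bullet> (z - v) - 1 * ((z - v) \<bullet> (z - v)) = 1 * (r\<^sup>2 - (dist c z)\<^sup>2)"
    by metis
  have "(dist c z)\<^sup>2 = r\<^sup>2" if "z \<in> T" for z
    using that eq[of z] lp lq T(1) by auto
  then have "dist c z = r" if "z \<in> T" for z
    using that r by (metis less_imp_le power2_eq_imp_eq zero_le_dist)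
  then have "T \<subseteq> sphere c r" by auto
  then show ?thesis using r that by blast
qed

lemma general_position_subset: "general_position S \<Longrightarrow> U \<subseteq> S \<Longrightarrow> general_position U"
  unfolding general_position_def by (meson finite_subset subset_trans)

text \<open>A further point of \<open>S\<close> on the circumcircle would give four concyclic points, so \<open>T\<close> and the two
  sides of its circle partition \<open>S\<close>.\<close>

lemma circumcircle_partition:
  assumes "general_position S" "T \<subseteq> S" "card T = 3"
  shows "S \<inter> circumcircle T = T"
    and "S - T - circumdisc T = S \<inter> circumexterior T"
    and "S - T - circumexterior T = S \<inter> circumdisc T"
    and "card (S \<inter> circumdisc T) + card (S \<inter> circumexterior T) = card S - 3"
    and "T \<inter> circumdisc T = {}" "T \<inter> circumexterior T = {}"
proof -
  have nc: "\<not> collinear T" using assms by (simp add: general_position_def)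
  obtain c r where cr: "r > 0" "T \<subseteq> sphere c r" using circumcircle_exists[OF assms(3) nc] .
  note eqs = circumcircle_eq[OF nc cr]
  have finS: "finite S" using assms(1) by (simp add: general_position_def)
  have "z \<in> T" if "z \<in> S" "z \<in> sphere c r" for z
  proof (rule ccontr)
    assume "z \<notin> T"
    moreover have "finite T" using finS assms(2) finite_subset by blast
    ultimately have "card (insert z T) = 4" using assms(3) by simp
    moreover have "concyclic (insert z T)"
      unfolding concyclic_def circle_def using cr that(2) by blast
    moreover have "insert z T \<subseteq> S" using assms(2) that(1) by simp
    ultimately show False using assms(1) by (simp add: general_position_def)
  qed
  then show on: "S \<inter> circumcircle T = T" unfolding eqs using cr(2) assms(2) by blast
  then have on': "T = S \<inter> sphere c r" unfolding eqs by simp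
  then have ST: "S - T = S - sphere c r" by blast
  have T_sub: "z \<in> T \<Longrightarrow> dist c z = r" for z using cr(2) by auto
  show "S - T - circumdisc T = S \<inter> circumexterior T"
    "S - T - circumexterior T = S \<inter> circumdisc T"
    unfolding eqs ST by auto
  show "T \<inter> circumdisc T = {}" "T \<inter> circumexterior T = {}"
    unfolding eqs by (auto dest: T_sub)
  have "S - T = (S \<inter> circumdisc T) \<union> (S \<inter> circumexterior T)"
    unfolding eqs ST by auto
  moreover have "(S \<inter> circumdisc T) \<inter> (S \<inter> circumexterior T) = {}"
    unfolding eqs by auto
  ultimately have "card (S \<inter> circumdisc T) + card (S \<inter> circumexterior T) = card (S - T)"
    using finS by (simp add: card_Un_disjoint)
  also have "\<dots> = card S - 3"
    using assms(2,3) finite_subset[OF assms(2) finS] by (simp add: card_Diff_subset)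
  finally show "card (S \<inter> circumdisc T) + card (S \<inter> circumexterior T) = card S - 3" .
qed

lemma splitting_iff:
  assumes "general_position S"
  shows "splitting a b S C \<longleftrightarrow> (\<exists>T. T \<subseteq> S \<and> card T = 3 \<and> C = circumcircle T \<and>
           card (S \<inter> circumdisc T) = a \<and> card (S \<inter> circumexterior T) = b)"
proof -
  have nc: "\<not> collinear T" if "T \<subseteq> S" "card T = 3" for T
    using assms that by (simp add: general_position_def)
  show ?thesis
  proof
    assume "splitting a b S C"
    then obtain c r T where *: "r > 0" "C = sphere c r" "T \<subseteq> S" "card T = 3" "T \<subseteq> sphere c r"
      "card (S \<inter> ball c r) = a" "card (S - cball c r) = b"
      unfolding splitting_def by blast
    note eqs = circumcircle_eq[OF nc[OF *(3,4)] *(1,5)]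
    show "\<exists>T. T \<subseteq> S \<and> card T = 3 \<and> C = circumcircle T \<and>
           card (S \<inter> circumdisc T) = a \<and> card (S \<inter> circumexterior T) = b"
      by (intro exI[of _ T]) (use * in \<open>simp add: eqs Diff_eq\<close>)
  next
    assume "\<exists>T. T \<subseteq> S \<and> card T = 3 \<and> C = circumcircle T \<and>
           card (S \<inter> circumdisc T) = a \<and> card (S \<inter> circumexterior T) = b"
    then obtain T where *: "T \<subseteq> S" "card T = 3" "C = circumcircle T"
      "card (S \<inter> circumdisc T) = a" "card (S \<inter> circumexterior T) = b" by blast
    obtain c r where cr: "r > 0" "T \<subseteq> sphere c r" using circumcircle_exists[OF *(2) nc[OF *(1,2)]] .
    note eqs = circumcircle_eq[OF nc[OF *(1,2)] cr]
    show "splitting a b S C"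
      unfolding splitting_def
      by (intro exI[of _ c] exI[of _ r]) (use * cr in \<open>auto simp: eqs Diff_eq\<close>)
  qed
qed

section \<open>Empty circles with a prescribed middle vertex\<close>

text \<open>This is the heart of the proof. In coordinates centred at \<open>v\<close> with axes \<open>e\<close> and \<open>d\<close>, let \<open>X z\<close>
  and \<open>Y z\<close> be the products of \<open>z - v\<close> with \<open>e\<close> and \<open>d\<close>, and let \<open>s z\<close> be the squared distance from
  \<open>v\<close>. Up to a positive factor, the inversion at \<open>v\<close> takes \<open>z\<close> to the point with homogeneous coordinates
  \<open>(X z, Y z, s z)\<close>, and dividing by \<open>\<bar>X z\<bar>\<close> gives the normal form \<open>(-1, u z, w z)\<close> or
  \<open>(1, u z, w z)\<close> required by \<open>unique_bridge\<close>. The line through the images of \<open>p\<close> and \<open>q\<close> is the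
  image of the circle through \<open>p\<close>, \<open>v\<close> and \<open>q\<close>. Its upper half plane corresponds to the disc if
  \<open>H p q\<close> is positive and to the exterior if \<open>H p q\<close> is negative, so the two sides of the
  circle are, in one order or the other, the two sides of the line.\<close>

lemma two_empty_circles_with_middle:
  fixes U :: "(real^2) set" and e d v :: "real^2"
  defines "L \<equiv> {z \<in> U. e \<bullet> z < e \<bullet> v}" and "R \<equiv> {z \<in> U. e \<bullet> v < e \<bullet> z}"
  assumes gp: "general_position U" and v: "v \<in> U"
    and inj: "inj_on (\<lambda>z. e \<bullet> z) U"
    and d: "d \<noteq> 0" "orthogonal e d"
    and ne: "L \<noteq> {}" "R \<noteq> {}"
  shows "(\<Sum>(p, q)\<in>L \<times> R. of_bool (circumdisc {p, v, q} \<inter> U = {}) +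
            of_bool (circumexterior {p, v, q} \<inter> U = {})) = (2::nat)"
proof -
  define X where "X z = e \<bullet> (z - v)" for z
  define s where "s z = (z - v) \<bullet> (z - v)" for z
  define u where "u z = (d \<bullet> (z - v)) / \<bar>X z\<bar>" for z
  define w where "w z = s z / \<bar>X z\<bar>" for z
  define H where "H p q = (u p + u q) / (w p + w q)" for p q
  define \<Phi> where "\<Phi> p q z = (d - (u q - H p q * w q) *\<^sub>R e) \<bullet> (z - v) - H p q * s z" for p q z
  \<comment> \<open>\<open>\<Phi> p q\<close> is the equation of the circle through \<open>p\<close>, \<open>v\<close>, \<open>q\<close>; the coefficient of \<open>e\<close> is chosen
    so that it vanishes at \<open>q\<close>, and \<open>bal\<close> below makes it vanish at \<open>p\<close> as well.\<close>
  have finU: "finite U" using gp by (simp add: general_position_def)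
  have fin: "finite L" "finite R" using finU by (auto simp: L_def R_def)
  have XL: "X z < 0" if "z \<in> L" for z using that by (simp add: L_def X_def inner_diff_right)
  have XR: "X z > 0" if "z \<in> R" for z using that by (simp add: R_def X_def inner_diff_right)
  have LU: "L \<subseteq> U" and RU: "R \<subseteq> U" by (auto simp: L_def R_def)
  have U: "U = insert v (L \<union> R)"
  proof
    show "U \<subseteq> insert v (L \<union> R)"
    proof
      fix z assume z: "z \<in> U"
      then have "e \<bullet> z = e \<bullet> v \<Longrightarrow> z = v" using inj v by (simp add: inj_on_def)
      with z show "z \<in> insert v (L \<union> R)" unfolding L_def R_def by fastforce
    qed
  qed (use v LU RU in auto)
  have notv: "z \<noteq> v" if "z \<in> L \<union> R" for z using that by (auto simp: L_def R_def)
  have disj: "p \<noteq> q" if "p \<in> L" "q \<in> R" for p q using that by (auto simp: L_def R_def)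
  have w: "w z > 0" if "z \<in> L \<union> R" for z
  proof -
    have "X z \<noteq> 0" using XL[of z] XR[of z] that by fastforce
    moreover have "s z > 0" using notv[OF that] by (simp add: s_def)
    ultimately show ?thesis by (simp add: w_def)
  qed
  have bal: "u p - H p q * w p = - (u q - H p q * w q)" if "p \<in> L" "q \<in> R" for p q
  proof -
    have "w p + w q > 0" using w[of p] w[of q] that by simp
    then have "H p q * (w p + w q) = u p + u q" by (simp add: H_def)
    then show ?thesis by (simp add: algebra_simps)
  qed
  have \<Phi>_alt: "\<Phi> p q z = d \<bullet> (z - v) - (u q - H p q * w q) * X z - H p q * s z" for p q z
    by (simp add: \<Phi>_def X_def inner_diff_left)
  have \<Phi>_v: "\<Phi> p q v = 0" for p q by (simp add: \<Phi>_def s_def)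
  have \<Phi>_R: "\<Phi> p q z = X z * ((u z - H p q * w z) - (u q - H p q * w q))" if "z \<in> R" for p q z
  proof -
    have "d \<bullet> (z - v) = u z * X z" "s z = w z * X z" using XR[OF that] by (auto simp: u_def w_def)
    then show ?thesis unfolding \<Phi>_alt by (simp add: algebra_simps)
  qed
  have \<Phi>_L: "\<Phi> p q z = - X z * ((u z - H p q * w z) - (u p - H p q * w p))"
    if "z \<in> L" "p \<in> L" "q \<in> R" for p q z
  proof -
    have "d \<bullet> (z - v) = - (u z * X z)" "s z = - (w z * X z)" using XL[OF that(1)] by (auto simp: u_def w_def)
    then show ?thesis unfolding \<Phi>_alt bal[OF that(2,3)] by (simp add: algebra_simps)
  qed
  have circ: "\<exists>c r. r > 0 \<and> (\<forall>z. \<Phi> p q z = H p q * (r\<^sup>2 - (dist c z)\<^sup>2))"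
    and noncol: "\<not> collinear {p, v, q}" and H0: "H p q \<noteq> 0"
    if "p \<in> L" "q \<in> R" for p q
  proof -
    let ?l = "d - (u q - H p q * w q) *\<^sub>R e"
    have c3: "card {p, v, q} = 3" using notv[of p] notv[of q] disj[OF that] that by auto
    have sub: "{p, v, q} \<subseteq> U" using that v LU RU by auto
    show nc: "\<not> collinear {p, v, q}" using c3 sub gp by (auto simp: general_position_def)
    have l0: "?l \<noteq> 0"
    proof
      assume "?l = 0"
      then have "d = (u q - H p q * w q) *\<^sub>R e" by simp
      then have "d \<bullet> d = (u q - H p q * w q) * (e \<bullet> d)" by (metis inner_scaleR_left)
      then have "d \<bullet> d = 0" using d(2) by (simp add: orthogonal_def)
      then show False using d(1) by simp
    qed
    have "\<Phi> p q p = 0" "\<Phi> p q q = 0" using \<Phi>_L[of p p q] \<Phi>_R[of q p q] that by auto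
    then have zero: "\<Phi> p q z = 0" if "z \<in> {p, v, q}" for z using that \<Phi>_v by auto
    \<comment> \<open>For \<open>H p q = 0\<close> the equation would be affine and put the three points on a line.\<close>
    show H0: "H p q \<noteq> 0"
    proof
      assume "H p q = 0"
      then have "?l \<bullet> z = ?l \<bullet> v" if "z \<in> {p, v, q}" for z
        using zero[OF that] by (simp add: \<Phi>_def inner_diff_right)
      then show False using collinear_if_orthogonal[OF l0, of "{p, v, q}" "?l \<bullet> v"] nc by blast
    qed
    show "\<exists>c r. r > 0 \<and> (\<forall>z. \<Phi> p q z = H p q * (r\<^sup>2 - (dist c z)\<^sup>2))"
      by (rule pencil_circle[OF H0 l0, of v]) (unfold \<Phi>_def s_def, blast)
  qed
  have on_circle: "z \<in> {p, v, q}" if pqz: "p \<in> L" "q \<in> R" "z \<in> U" "\<Phi> p q z = 0" for p q z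
  proof (rule ccontr)
    assume z: "z \<notin> {p, v, q}"
    obtain c r where cr: "r > 0" "\<And>z. \<Phi> p q z = H p q * (r\<^sup>2 - (dist c z)\<^sup>2)"
      using circ[OF pqz(1,2)] by blast
    have "y \<in> sphere c r" if "\<Phi> p q y = 0" for y
      using that cr H0[OF \<open>p \<in> L\<close> \<open>q \<in> R\<close>] by simp
    moreover have "\<Phi> p q p = 0" "\<Phi> p q q = 0" using \<Phi>_L[of p p q] \<Phi>_R[of q p q] pqz by auto
    ultimately have "{p, v, q, z} \<subseteq> sphere c r" using pqz \<Phi>_v by blast
    then have "concyclic {p, v, q, z}" using cr(1) unfolding concyclic_def circle_def by blast
    moreover have "card {p, v, q, z} = 4" using notv[of p] notv[of q] disj[OF pqz(1,2)] pqz z by auto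
    moreover have "{p, v, q, z} \<subseteq> U" using pqz v by (auto simp: L_def R_def)
    ultimately show False using gp unfolding general_position_def by blast
  qed
  define up where "up p q \<longleftrightarrow> (\<forall>r\<in>L. u r - H p q * w r \<le> u p - H p q * w p) \<and>
                               (\<forall>r\<in>R. u r - H p q * w r \<le> u q - H p q * w q)" for p q
  define dn where "dn p q \<longleftrightarrow> (\<forall>r\<in>L. u r - H p q * w r \<ge> u p - H p q * w p) \<and>
                               (\<forall>r\<in>R. u r - H p q * w r \<ge> u q - H p q * w q)" for p q
  have genL: "r = p" if "p \<in> L" "q \<in> R" "r \<in> L" "u r - H p q * w r = u p - H p q * w p" for p q r
    using on_circle[OF that(1,2), of r] \<Phi>_L[OF that(3,1,2)] that notv[of r] disj[of r q] LU by auto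
  have genR: "r = q" if "p \<in> L" "q \<in> R" "r \<in> R" "u r - H p q * w r = u q - H p q * w q" for p q r
    using on_circle[OF that(1,2), of r] \<Phi>_R[OF that(3)] that notv[of r] disj[of p r] RU by auto
  have card_up: "card {(p, q) \<in> L \<times> R. up p q} = 1"
    unfolding up_def H_def
    by (rule unique_bridge[OF fin ne w]) (use genL genR in \<open>auto simp: H_def\<close>)
  \<comment> \<open>The lower bridge is the upper bridge of the reflected configuration \<open>- u\<close>.\<close>
  have card_dn: "card {(p, q) \<in> L \<times> R. dn p q} = 1"
  proof -
    have neg: "(- u p + - u q) / (w p + w q) = - H p q" for p q
      by (simp add: H_def minus_divide_left)
    have flip: "- x - (- h) * y \<le> - x' - (- h) * y' \<longleftrightarrow> x' - h * y' \<le> x - h * y"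
      "- x - (- h) * y = - x' - (- h) * y' \<longleftrightarrow> x - h * y = x' - h * y'" for x x' y y' h :: real
      by auto
    have "card {(p, q) \<in> L \<times> R.
         (\<forall>r\<in>L. - u r - ((- u p + - u q) / (w p + w q)) * w r \<le> - u p - ((- u p + - u q) / (w p + w q)) * w p) \<and>
         (\<forall>r\<in>R. - u r - ((- u p + - u q) / (w p + w q)) * w r \<le> - u q - ((- u p + - u q) / (w p + w q)) * w q)} = 1"
    proof (rule unique_bridge[OF fin ne w, where u = "\<lambda>z. - u z"])
      fix p q r assume *: "p \<in> L" "q \<in> R" "r \<in> L"
        "- u r - ((- u p + - u q) / (w p + w q)) * w r = - u p - ((- u p + - u q) / (w p + w q)) * w p"
      from *(4) show "r = p" unfolding neg flip by (rule genL[OF *(1-3)])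
    next
      fix p q r assume *: "p \<in> L" "q \<in> R" "r \<in> R"
        "- u r - ((- u p + - u q) / (w p + w q)) * w r = - u q - ((- u p + - u q) / (w p + w q)) * w q"
      from *(4) show "r = q" unfolding neg flip by (rule genR[OF *(1-3)])
    qed simp
    also have "{(p, q) \<in> L \<times> R.
         (\<forall>r\<in>L. - u r - ((- u p + - u q) / (w p + w q)) * w r \<le> - u p - ((- u p + - u q) / (w p + w q)) * w p) \<and>
         (\<forall>r\<in>R. - u r - ((- u p + - u q) / (w p + w q)) * w r \<le> - u q - ((- u p + - u q) / (w p + w q)) * w q)}
       = {(p, q) \<in> L \<times> R. dn p q}"
      unfolding neg dn_def flip by simp
    finally show ?thesis .
  qed
  \<comment> \<open>The pair is an upper or a lower bridge iff \<open>\<Phi> p q\<close> has no positive or no negative values on \<open>U\<close>;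
    the sign of \<open>H p q\<close> decides which of the two conditions says that the disc is empty.\<close>
  have key: "of_bool (circumdisc {p, v, q} \<inter> U = {}) + of_bool (circumexterior {p, v, q} \<inter> U = {})
      = (of_bool (up p q) + of_bool (dn p q) :: nat)" if pq: "p \<in> L" "q \<in> R" for p q
  proof -
    obtain c r where cr: "r > 0" "\<And>z. \<Phi> p q z = H p q * (r\<^sup>2 - (dist c z)\<^sup>2)"
      using circ[OF pq] by blast
    have "\<Phi> p q p = 0" "\<Phi> p q q = 0" using \<Phi>_L[of p p q] \<Phi>_R[of q p q] pq by auto
    then have "{p, v, q} \<subseteq> sphere c r" using cr H0[OF pq] \<Phi>_v[of p q] by auto
    note disc = circumcircle_eq[OF noncol[OF pq] cr(1) this]
    have sq: "r\<^sup>2 - (dist c z)\<^sup>2 > 0 \<longleftrightarrow> dist c z < r" "r\<^sup>2 - (dist c z)\<^sup>2 < 0 \<longleftrightarrow> dist c z > r" for z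
      using cr(1) power_mono_iff[of "dist c z" r 2] power_mono_iff[of r "dist c z" 2] zero_le_dist[of c z]
      by (simp_all add: not_le[symmetric] del: not_le)
    have up_iff: "up p q \<longleftrightarrow> (\<forall>z\<in>U. \<Phi> p q z \<le> 0)"
    proof -
      have "\<Phi> p q z \<le> 0 \<longleftrightarrow> u z - H p q * w z \<le> u p - H p q * w p" if "z \<in> L" for z
        unfolding \<Phi>_L[OF that pq] using XL[OF that] by (simp add: mult_le_0_iff zero_le_mult_iff)
      moreover have "\<Phi> p q z \<le> 0 \<longleftrightarrow> u z - H p q * w z \<le> u q - H p q * w q" if "z \<in> R" for z
        unfolding \<Phi>_R[OF that] using XR[OF that] by (simp add: mult_le_0_iff)
      ultimately show ?thesis unfolding U up_def using \<Phi>_v[of p q] by auto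
    qed
    have dn_iff: "dn p q \<longleftrightarrow> (\<forall>z\<in>U. \<Phi> p q z \<ge> 0)"
    proof -
      have "\<Phi> p q z \<ge> 0 \<longleftrightarrow> u z - H p q * w z \<ge> u p - H p q * w p" if "z \<in> L" for z
        unfolding \<Phi>_L[OF that pq] using XL[OF that] by (simp add: mult_le_0_iff zero_le_mult_iff)
      moreover have "\<Phi> p q z \<ge> 0 \<longleftrightarrow> u z - H p q * w z \<ge> u q - H p q * w q" if "z \<in> R" for z
        unfolding \<Phi>_R[OF that] using XR[OF that] by (simp add: zero_le_mult_iff)
      ultimately show ?thesis unfolding U dn_def using \<Phi>_v[of p q] by auto
    qed
    have disc_iff: "circumdisc {p, v, q} \<inter> U = {} \<longleftrightarrow> (\<forall>z\<in>U. \<not> r\<^sup>2 - (dist c z)\<^sup>2 > 0)"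
      unfolding disc sq by auto
    have ext_iff: "circumexterior {p, v, q} \<inter> U = {} \<longleftrightarrow> (\<forall>z\<in>U. \<not> r\<^sup>2 - (dist c z)\<^sup>2 < 0)"
      unfolding disc sq by (auto simp: disjoint_iff not_less)
    show ?thesis
    proof (cases "H p q > 0")
      case True
      then have "\<Phi> p q z \<le> 0 \<longleftrightarrow> \<not> r\<^sup>2 - (dist c z)\<^sup>2 > 0" "\<Phi> p q z \<ge> 0 \<longleftrightarrow> \<not> r\<^sup>2 - (dist c z)\<^sup>2 < 0" for z
        unfolding cr(2) by (auto simp: mult_le_0_iff zero_le_mult_iff)
      then show ?thesis
        unfolding up_iff dn_iff disc_iff ext_iff by simp
    next
      case False
      then have "H p q < 0" using H0[OF pq] by simp
      then have "\<Phi> p q z \<le> 0 \<longleftrightarrow> \<not> r\<^sup>2 - (dist c z)\<^sup>2 < 0" "\<Phi> p q z \<ge> 0 \<longleftrightarrow> \<not> r\<^sup>2 - (dist c z)\<^sup>2 > 0" for z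
        unfolding cr(2) by (auto simp: mult_le_0_iff zero_le_mult_iff)
      then show ?thesis
        unfolding up_iff dn_iff disc_iff ext_iff by simp
    qed
  qed
  have "(\<Sum>(p, q)\<in>L \<times> R. of_bool (circumdisc {p, v, q} \<inter> U = {}) +
            of_bool (circumexterior {p, v, q} \<inter> U = {}))
      = (\<Sum>(p, q)\<in>L \<times> R. of_bool (up p q) + of_bool (dn p q) :: nat)"
  proof (rule sum.cong[OF refl])
    fix x assume "x \<in> L \<times> R"
    then obtain p q where "x = (p, q)" "p \<in> L" "q \<in> R" by blast
    then show "(case x of (p, q) \<Rightarrow> of_bool (circumdisc {p, v, q} \<inter> U = {}) +
            of_bool (circumexterior {p, v, q} \<inter> U = {}))
      = (case x of (p, q) \<Rightarrow> of_bool (up p q) + (of_bool (dn p q) :: nat))"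
      using key by simp
  qed
  also have "\<dots> = (\<Sum>x\<in>L \<times> R. of_bool (case x of (p, q) \<Rightarrow> up p q)) + (\<Sum>x\<in>L \<times> R. of_bool (case x of (p, q) \<Rightarrow> dn p q))"
    by (simp only: sum.distrib[symmetric] case_prod_unfold)
  also have "\<dots> = card {(p, q) \<in> L \<times> R. up p q} + card {(p, q) \<in> L \<times> R. dn p q}"
  proof -
    have "L \<times> R \<inter> {x. case x of (p, q) \<Rightarrow> P p q} = {(p, q) \<in> L \<times> R. P p q}" for P by auto
    then show ?thesis using fin by simp
  qed
  finally show ?thesis using card_up card_dn by simp
qed

section \<open>The number of empty circles\<close>

text \<open>The directions that fail to separate some pair of points form a finite union of hyperplanes, which
  is a null set.\<close>

lemma ex_injective_direction:
  fixes S :: "'a::euclidean_space set"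
  assumes "finite S"
  shows "\<exists>e. inj_on (\<lambda>z. e \<bullet> z) S"
proof -
  let ?N = "\<Union>(p, q)\<in>{(p, q) \<in> S \<times> S. p \<noteq> q}. {z. (p - q) \<bullet> z = 0}"
  have "finite {(p, q) \<in> S \<times> S. p \<noteq> q}"
    by (rule finite_subset[OF _ finite_cartesian_product[OF assms assms]]) blast
  then have "negligible ?N"
    by (intro negligible_Union finite_imageI) (auto intro!: negligible_hyperplane)
  then have "?N \<noteq> UNIV" using non_negligible_UNIV by metis
  then obtain e where "e \<notin> ?N" by blast
  then have "(p - q) \<bullet> e \<noteq> 0" if "p \<in> S" "q \<in> S" "p \<noteq> q" for p q
    using that by blast
  then have "inj_on (\<lambda>z. e \<bullet> z) S"
    by (intro inj_onI) (metis inner_commute inner_diff_left right_minus_eq)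
  then show ?thesis ..
qed

text \<open>A triple corresponds to its middle element together with the elements below and above it.\<close>

lemma sum_triples_by_middle:
  fixes f :: "'a \<Rightarrow> real" and g :: "'a set \<Rightarrow> nat"
  assumes "finite U" "inj_on f U"
  shows "(\<Sum>T | T \<subseteq> U \<and> card T = 3. g T)
    = (\<Sum>v\<in>U. \<Sum>(p, q)\<in>{z \<in> U. f z < f v} \<times> {z \<in> U. f v < f z}. g {p, v, q})"
proof -
  let ?B = "\<lambda>v. {z \<in> U. f z < f v} \<times> {z \<in> U. f v < f z}"
  let ?h = "\<lambda>(v, p, q). {p, v, q}"
  have "bij_betw ?h (Sigma U ?B) {T. T \<subseteq> U \<and> card T = 3}"
    unfolding bij_betw_def
  proof
    show "inj_on ?h (Sigma U ?B)"
    proof (rule inj_onI)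
      fix x y assume x: "x \<in> Sigma U ?B" and y: "y \<in> Sigma U ?B" and xy: "?h x = ?h y"
      obtain v p q v' p' q' where x_eq: "x = (v, p, q)" and y_eq: "y = (v', p', q')"
        by (metis prod.exhaust)
      have mem: "p \<in> U" "q \<in> U" "p' \<in> U" "q' \<in> U"
        and ord: "f p < f v" "f v < f q" "f p' < f v'" "f v' < f q'"
        using x y by (simp_all add: x_eq y_eq)
      have eq: "{p, v, q} = {p', v', q'}" using xy by (simp add: x_eq y_eq)
      \<comment> \<open>The outer elements are recovered from the triple by the extreme values of \<open>f\<close>.\<close>
      have img: "{f p, f v, f q} = {f p', f v', f q'}" using arg_cong[OF eq, of "image f"] by simp
      have "Min {f p, f v, f q} = f p" "Max {f p, f v, f q} = f q" using ord by auto
      moreover have "Min {f p', f v', f q'} = f p'" "Max {f p', f v', f q'} = f q'" using ord by auto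
      ultimately have fpq: "f p = f p'" "f q = f q'" using img by simp_all
      then have pq: "p = p'" "q = q'" using assms(2) mem by (auto dest: inj_onD)
      have "v \<noteq> p" "v \<noteq> q" "v \<in> {p', v', q'}" using ord eq by auto
      then have "v = v'" using pq by simp
      with pq show "x = y" by (simp add: x_eq y_eq)
    qed
    show "?h ` Sigma U ?B = {T. T \<subseteq> U \<and> card T = 3}"
    proof (intro equalityI subsetI)
      fix T assume "T \<in> ?h ` Sigma U ?B"
      then obtain v p q where *: "T = {p, v, q}" "{p, v, q} \<subseteq> U" "f p < f v" "f v < f q" by auto
      then have "p \<noteq> v" "v \<noteq> q" "p \<noteq> q" by auto
      then show "T \<in> {T. T \<subseteq> U \<and> card T = 3}" using * by simp
    next
      fix T assume "T \<in> {T. T \<subseteq> U \<and> card T = 3}"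
      then obtain x y z where T: "T = {x, y, z}" "T \<subseteq> U" "x \<noteq> y" "y \<noteq> z" "x \<noteq> z"
        by (auto simp: card_3_iff)
      have "f x \<noteq> f y" "f y \<noteq> f z" "f x \<noteq> f z"
        using T assms(2) by (auto simp: inj_on_def)
      moreover have mem: "T \<in> ?h ` Sigma U ?B" if "T = {p, v, q}" "f p < f v" "f v < f q" for p v q
        using that T(2) by (intro image_eqI[of _ _ "(v, p, q)"]) auto
      moreover have "T = {x, z, y}" "T = {y, x, z}" "T = {y, z, x}" "T = {z, x, y}" "T = {z, y, x}"
        using T(1) by auto
      ultimately show "T \<in> ?h ` Sigma U ?B" using T(1) by (metis linorder_less_linear)
    qed
  qed
  from sum.reindex_bij_betw[OF this, of g]
  have "(\<Sum>T | T \<subseteq> U \<and> card T = 3. g T) = (\<Sum>(v, p, q)\<in>Sigma U ?B. g {p, v, q})"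
    by (simp add: case_prod_unfold)
  also have "\<dots> = (\<Sum>v\<in>U. \<Sum>(p, q)\<in>?B v. g {p, v, q})"
    using assms(1) by (subst sum.Sigma) (auto simp: case_prod_unfold)
  finally show ?thesis .
qed

text \<open>Only the points where \<open>f\<close> attains its minimum and its maximum are excluded.\<close>

lemma card_inner_points:
  fixes f :: "'a \<Rightarrow> real"
  assumes "finite U" "inj_on f U" "card U \<ge> 2"
  shows "card {v \<in> U. {z \<in> U. f z < f v} \<noteq> {} \<and> {z \<in> U. f v < f z} \<noteq> {}} = card U - 2"
proof -
  have "U \<noteq> {}" using assms(3) by auto
  then have "Min (f ` U) \<in> f ` U" "Max (f ` U) \<in> f ` U" using assms(1) by simp_all
  then obtain x y where x: "x \<in> U" "Min (f ` U) = f x" and y: "y \<in> U" "Max (f ` U) = f y" by blast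
  have x_le: "f x \<le> f z" and le_y: "f z \<le> f y" if "z \<in> U" for z
    using assms(1) that by (simp_all flip: x(2) y(2))
  have "x \<noteq> y"
  proof
    assume "x = y"
    then have "f z = f x" if "z \<in> U" for z using x_le[OF that] le_y[OF that] by simp
    then have "z = x" if "z \<in> U" for z using inj_onD[OF assms(2) _ that x(1)] that by blast
    then have "U \<subseteq> {x}" by blast
    then have "card U \<le> 1" using card_mono[of "{x}" U] by simp
    then show False using assms(3) by simp
  qed
  have strict: "f x < f z" if "z \<in> U" "z \<noteq> x" for z
    using x_le[OF that(1)] inj_onD[OF assms(2), of z x] x(1) that by fastforce
  have strict': "f z < f y" if "z \<in> U" "z \<noteq> y" for z
    using le_y[OF that(1)] inj_onD[OF assms(2), of z y] y(1) that by fastforce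
  have "{v \<in> U. {z \<in> U. f z < f v} \<noteq> {} \<and> {z \<in> U. f v < f z} \<noteq> {}} = U - {x, y}"
    (is "?I = _")
  proof (intro equalityI subsetI)
    fix v assume "v \<in> ?I"
    then show "v \<in> U - {x, y}" by (auto simp: not_le[symmetric] x_le le_y simp del: not_le)
  next
    fix v assume v: "v \<in> U - {x, y}"
    then have "x \<in> {z \<in> U. f z < f v}" "y \<in> {z \<in> U. f v < f z}"
      using strict[of v] strict'[of v] x(1) y(1) by auto
    then show "v \<in> ?I" using v by blast
  qed
  then show ?thesis using assms(1) x(1) y(1) \<open>x \<noteq> y\<close> by (simp add: card_Diff_subset)
qed

text \<open>This is the formula \<open>2 * (card U - 2)\<close> for the number of facets of a simplicial polytope in space,
  applied to the lifting of \<open>U\<close> to a paraboloid; equivalently, it counts the Delaunay triangles and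
  the farthest-point Delaunay triangles of \<open>U\<close> together. For three points both terms count the same triple.\<close>

lemma card_empty_circles:
  assumes "general_position U" "card U \<ge> 3"
  shows "card {T. T \<subseteq> U \<and> card T = 3 \<and> circumdisc T \<inter> U = {}}
       + card {T. T \<subseteq> U \<and> card T = 3 \<and> circumexterior T \<inter> U = {}} = 2 * (card U - 2)"
proof -
  have fin: "finite U" using assms(1) by (simp add: general_position_def)
  obtain e where inj: "inj_on (\<lambda>z. e \<bullet> z) U" using ex_injective_direction[OF fin] by blast
  obtain d :: "real^2" where d: "d \<noteq> 0" "orthogonal e d"
    using orthogonal_to_vector_exists[of e] by auto
  let ?L = "\<lambda>v. {z \<in> U. e \<bullet> z < e \<bullet> v}" and ?R = "\<lambda>v. {z \<in> U. e \<bullet> v < e \<bullet> z}"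
  let ?g = "\<lambda>T. of_bool (circumdisc T \<inter> U = {}) + of_bool (circumexterior T \<inter> U = {}) :: nat"
  have finT: "finite {T. T \<subseteq> U \<and> card T = 3}" using fin by simp
  have card_eq: "card {T. T \<subseteq> U \<and> card T = 3 \<and> P T} = (\<Sum>T | T \<subseteq> U \<and> card T = 3. of_bool (P T))" for P
    using finT by (simp add: Int_def conj_assoc)
  have "card {T. T \<subseteq> U \<and> card T = 3 \<and> circumdisc T \<inter> U = {}}
       + card {T. T \<subseteq> U \<and> card T = 3 \<and> circumexterior T \<inter> U = {}}
      = (\<Sum>T | T \<subseteq> U \<and> card T = 3. ?g T)"
    unfolding card_eq by (rule sum.distrib[symmetric])
  also have "\<dots> = (\<Sum>v\<in>U. \<Sum>(p, q)\<in>?L v \<times> ?R v. ?g {p, v, q})"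
    by (rule sum_triples_by_middle[OF fin inj])
  also have "\<dots> = (\<Sum>v\<in>U. 2 * of_bool (?L v \<noteq> {} \<and> ?R v \<noteq> {}))"
  proof (rule sum.cong[OF refl])
    fix v assume v: "v \<in> U"
    show "(\<Sum>(p, q)\<in>?L v \<times> ?R v. ?g {p, v, q}) = 2 * of_bool (?L v \<noteq> {} \<and> ?R v \<noteq> {})"
    proof (cases "?L v \<noteq> {} \<and> ?R v \<noteq> {}")
      case True
      then show ?thesis using two_empty_circles_with_middle[OF assms(1) v inj d] by simp
    next
      case False
      then have "?L v \<times> ?R v = {}" by (simp only: Times_empty) blast
      then show ?thesis using False by (simp only: sum.empty) simp
    qed
  qed
  also have "\<dots> = 2 * card {v \<in> U. ?L v \<noteq> {} \<and> ?R v \<noteq> {}}"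
    using fin by (simp only: sum_distrib_left[symmetric] sum_of_bool_eq of_nat_id Int_def mem_Collect_eq)
  also have "\<dots> = 2 * (card U - 2)"
    using card_inner_points[OF fin inj] assms(2) by simp
  finally show ?thesis .
qed

section \<open>Double counting\<close>

lemma card_supersets_avoiding:
  assumes "finite S" "T \<subseteq> S" "card T = m" "T \<inter> A = {}"
  shows "card {U. U \<subseteq> S \<and> card U = k + m \<and> T \<subseteq> U \<and> A \<inter> U = {}} = (card (S - T - A) choose k)"
proof -
  have fin: "finite T" "finite (S - T - A)" using assms finite_subset by auto
  have "bij_betw (\<lambda>K. K \<union> T) {K. K \<subseteq> S - T - A \<and> card K = k}
      {U. U \<subseteq> S \<and> card U = k + m \<and> T \<subseteq> U \<and> A \<inter> U = {}}"
  proof (rule bij_betw_byWitness[where f' = "\<lambda>U. U - T"])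
    show "(\<lambda>K. K \<union> T) ` {K. K \<subseteq> S - T - A \<and> card K = k}
        \<subseteq> {U. U \<subseteq> S \<and> card U = k + m \<and> T \<subseteq> U \<and> A \<inter> U = {}}"
    proof clarify
      fix K assume K: "K \<subseteq> S - T - A" "k = card K"
      have "card (K \<union> T) = card K + m"
        using K fin assms(3) by (subst card_Un_disjoint) (auto intro: finite_subset)
      then show "K \<union> T \<subseteq> S \<and> card (K \<union> T) = card K + m \<and> T \<subseteq> K \<union> T \<and> A \<inter> (K \<union> T) = {}"
        using K assms(2,4) by blast
    qed
    show "(\<lambda>U. U - T) ` {U. U \<subseteq> S \<and> card U = k + m \<and> T \<subseteq> U \<and> A \<inter> U = {}}
        \<subseteq> {K. K \<subseteq> S - T - A \<and> card K = k}"
      using fin(1) assms(3) by (auto simp: card_Diff_subset)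
  qed auto
  then show ?thesis by (rule trans[OF bij_betw_same_card[symmetric] n_subsets[OF fin(2)]])
qed

text \<open>Both sides count the pairs of a set \<open>T\<close> with \<open>m\<close> elements and a superset \<open>U\<close> of \<open>T\<close> with \<open>k\<close>
  further elements, none of which lies in \<open>A T\<close>.\<close>

lemma sum_card_avoiding_subsets:
  assumes "finite S" and "\<And>T. T \<subseteq> S \<Longrightarrow> card T = m \<Longrightarrow> T \<inter> A T = {}"
  shows "(\<Sum>U | U \<subseteq> S \<and> card U = k + m. card {T. T \<subseteq> U \<and> card T = m \<and> A T \<inter> U = {}})
    = (\<Sum>T | T \<subseteq> S \<and> card T = m. card (S - T - A T) choose k)"
proof -
  have "(\<Sum>U | U \<subseteq> S \<and> card U = k + m. card {T. T \<subseteq> U \<and> card T = m \<and> A T \<inter> U = {}})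
     = (\<Sum>U | U \<subseteq> S \<and> card U = k + m. \<Sum>T | T \<subseteq> S \<and> card T = m. of_bool (T \<subseteq> U \<and> A T \<inter> U = {}))"
  proof (rule sum.cong[OF refl])
    fix U assume "U \<in> {U. U \<subseteq> S \<and> card U = k + m}"
    then have "{T. T \<subseteq> U \<and> card T = m \<and> A T \<inter> U = {}}
        = {T. T \<subseteq> S \<and> card T = m} \<inter> {T. T \<subseteq> U \<and> A T \<inter> U = {}}" by auto
    then show "card {T. T \<subseteq> U \<and> card T = m \<and> A T \<inter> U = {}}
        = (\<Sum>T | T \<subseteq> S \<and> card T = m. of_bool (T \<subseteq> U \<and> A T \<inter> U = {}))"
      using assms(1) by simp
  qed
  also have "\<dots> = (\<Sum>T | T \<subseteq> S \<and> card T = m. \<Sum>U | U \<subseteq> S \<and> card U = k + m. of_bool (T \<subseteq> U \<and> A T \<inter> U = {}))"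
    by (rule sum.swap)
  also have "\<dots> = (\<Sum>T | T \<subseteq> S \<and> card T = m. card (S - T - A T) choose k)"
  proof (rule sum.cong[OF refl])
    fix T assume T: "T \<in> {T. T \<subseteq> S \<and> card T = m}"
    have "{U. U \<subseteq> S \<and> card U = k + m} \<inter> {U. T \<subseteq> U \<and> A T \<inter> U = {}}
        = {U. U \<subseteq> S \<and> card U = k + m \<and> T \<subseteq> U \<and> A T \<inter> U = {}}" by auto
    then show "(\<Sum>U | U \<subseteq> S \<and> card U = k + m. of_bool (T \<subseteq> U \<and> A T \<inter> U = {})) = (card (S - T - A T) choose k)"
      using assms T card_supersets_avoiding[of S T m "A T" k] by simp
  qed
  finally show ?thesis .
qed

lemma sum_card_fibres:
  fixes c :: "'a \<Rightarrow> nat" and g :: "nat \<Rightarrow> nat"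
  assumes "finite A" "\<And>x. x \<in> A \<Longrightarrow> c x \<le> m"
  shows "(\<Sum>i\<le>m. card {x \<in> A. c x = i} * g i) = (\<Sum>x\<in>A. g (c x))"
proof -
  have "(\<Sum>x\<in>A. g (c x)) = (\<Sum>i\<le>m. \<Sum>x | x \<in> A \<and> c x = i. g (c x))"
    using assms by (intro sum.group[symmetric]) auto
  then show ?thesis by simp
qed

text \<open>Choosing \<open>k\<close> points of \<open>S\<close> on one side of a circle means choosing a superset \<open>U\<close> of the triple that
  avoids the other side. Thus the binomial moments of the side sizes are sums, over all \<open>U\<close> with
  \<open>k + 3\<close> elements, of the constant numbers found in \<open>card_empty_circles\<close>.\<close>

lemma card_circles_with_side_size:
  assumes gp: "general_position S" and S: "card S = m + 3" and j: "j \<le> m"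
  shows "card {T. T \<subseteq> S \<and> card T = 3 \<and> card (S \<inter> circumdisc T) = j}
       + card {T. T \<subseteq> S \<and> card T = 3 \<and> card (S \<inter> circumexterior T) = j} = 2 * (j + 1) * (m + 1 - j)"
proof -
  have fin: "finite S" using gp by (simp add: general_position_def)
  let ?T = "{T. T \<subseteq> S \<and> card T = 3}"
  have finT: "finite ?T" using fin by simp
  define E where "E i = card {T \<in> ?T. card (S \<inter> circumdisc T) = i}
       + card {T \<in> ?T. card (S \<inter> circumexterior T) = i}" for i
  have le: "card (S \<inter> circumdisc T) \<le> m" "card (S \<inter> circumexterior T) \<le> m" if "T \<in> ?T" for T
    using circumcircle_partition(4)[OF gp, of T] that S by auto
  have "(\<Sum>i\<le>m. E i * (i choose k)) = 2 * (k + 1) * (m + 3 choose (k + 3))" for k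
  proof -
    have "(\<Sum>i\<le>m. E i * (i choose k))
        = (\<Sum>T\<in>?T. card (S \<inter> circumdisc T) choose k) + (\<Sum>T\<in>?T. card (S \<inter> circumexterior T) choose k)"
      unfolding E_def add_mult_distrib sum.distrib
      using sum_card_fibres[OF finT le(1), of "\<lambda>T. T" "\<lambda>i. i choose k"] sum_card_fibres[OF finT le(2), of "\<lambda>T. T" "\<lambda>i. i choose k"] by simp
    also have "(\<Sum>T\<in>?T. card (S \<inter> circumdisc T) choose k) = (\<Sum>T\<in>?T. card (S - T - circumexterior T) choose k)"
      using circumcircle_partition(3)[OF gp] by (intro sum.cong) auto
    also have "\<dots> = (\<Sum>U | U \<subseteq> S \<and> card U = k + 3. card {T. T \<subseteq> U \<and> card T = 3 \<and> circumexterior T \<inter> U = {}})"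
      using sum_card_avoiding_subsets[OF fin, of 3 circumexterior k] circumcircle_partition(6)[OF gp] by simp
    also have "(\<Sum>T\<in>?T. card (S \<inter> circumexterior T) choose k) = (\<Sum>T\<in>?T. card (S - T - circumdisc T) choose k)"
      using circumcircle_partition(2)[OF gp] by (intro sum.cong) auto
    also have "\<dots> = (\<Sum>U | U \<subseteq> S \<and> card U = k + 3. card {T. T \<subseteq> U \<and> card T = 3 \<and> circumdisc T \<inter> U = {}})"
      using sum_card_avoiding_subsets[OF fin, of 3 circumdisc k] circumcircle_partition(5)[OF gp] by simp
    also have "(\<Sum>U | U \<subseteq> S \<and> card U = k + 3. card {T. T \<subseteq> U \<and> card T = 3 \<and> circumexterior T \<inter> U = {}})
        + (\<Sum>U | U \<subseteq> S \<and> card U = k + 3. card {T. T \<subseteq> U \<and> card T = 3 \<and> circumdisc T \<inter> U = {}})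
      = (\<Sum>U | U \<subseteq> S \<and> card U = k + 3. 2 * (k + 1))"
      unfolding sum.distrib[symmetric]
    proof (rule sum.cong[OF refl])
      fix U assume "U \<in> {U. U \<subseteq> S \<and> card U = k + 3}"
      then have "general_position U" "card U = k + 3" using general_position_subset[OF gp] by auto
      then show "card {T. T \<subseteq> U \<and> card T = 3 \<and> circumexterior T \<inter> U = {}}
          + card {T. T \<subseteq> U \<and> card T = 3 \<and> circumdisc T \<inter> U = {}} = 2 * (k + 1)"
        using card_empty_circles[of U] by simp
    qed
    also have "\<dots> = 2 * (k + 1) * (m + 3 choose (k + 3))"
      using n_subsets[OF fin, of "k + 3"] S by simp
    finally show ?thesis .
  qed
  then have "E j = 2 * (j + 1) * (m + 1 - j)"
    using counts_from_binomial_moments[of m E j] j by blast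
  then show ?thesis by (simp add: E_def conj_assoc)
qed

section \<open>Counting splitting circles\<close>

theorem theorem3p1:
  fixes n :: int and S :: "(real^2) set" and a b :: nat
  assumes "general_position S"
    and "int (card S) = 2 * n + 1"
    and "a < b"
    and "int a + int b = 2 * n - 2"
  shows "card {C. splitting a b S C \<or> splitting b a S C} = 2 * (a + 1) * (b + 1)"
proof -
  have cardS: "card S = a + b + 3" using assms(2,4) by linarith
  have fin: "finite S" using assms(1) by (simp add: general_position_def)
  define D where "D = {T. T \<subseteq> S \<and> card T = 3 \<and> card (S \<inter> circumdisc T) = a}"
  define E where "E = {T. T \<subseteq> S \<and> card T = 3 \<and> card (S \<inter> circumexterior T) = a}"
  have sum: "card (S \<inter> circumdisc T) + card (S \<inter> circumexterior T) = a + b" if "T \<subseteq> S" "card T = 3" for T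
    using circumcircle_partition(4)[OF assms(1) that] cardS by simp
  have "splitting a b S C \<longleftrightarrow> C \<in> circumcircle ` D" for C
  proof -
    have "card (S \<inter> circumdisc T) = a \<and> card (S \<inter> circumexterior T) = b
        \<longleftrightarrow> card (S \<inter> circumdisc T) = a" if "T \<subseteq> S" "card T = 3" for T
      using sum[OF that] by linarith
    then show ?thesis unfolding splitting_iff[OF assms(1)] D_def by blast
  qed
  moreover have "splitting b a S C \<longleftrightarrow> C \<in> circumcircle ` E" for C
  proof -
    have "card (S \<inter> circumdisc T) = b \<and> card (S \<inter> circumexterior T) = a
        \<longleftrightarrow> card (S \<inter> circumexterior T) = a" if "T \<subseteq> S" "card T = 3" for T
      using sum[OF that] by linarith
    then show ?thesis unfolding splitting_iff[OF assms(1)] E_def by blast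
  qed
  \<comment> \<open>A triple is recovered from its circle as the set of points of \<open>S\<close> on it, so circles may be
    counted as triples.\<close>
  ultimately have "{C. splitting a b S C \<or> splitting b a S C} = circumcircle ` (D \<union> E)" by auto
  moreover have "inj_on circumcircle (D \<union> E)"
  proof (rule inj_on_inverseI[where g = "\<lambda>C. S \<inter> C"])
    fix T assume "T \<in> D \<union> E"
    then have "T \<subseteq> S" "card T = 3" by (auto simp: D_def E_def)
    then show "S \<inter> circumcircle T = T" by (rule circumcircle_partition(1)[OF assms(1)])
  qed
  moreover have "D \<inter> E = {}"
  proof -
    have "\<not> (card (S \<inter> circumdisc T) = a \<and> card (S \<inter> circumexterior T) = a)"
      if "T \<subseteq> S" "card T = 3" for T
      using sum[OF that] assms(3) by linarith
    then show ?thesis unfolding D_def E_def by blast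
  qed
  moreover have "finite D" "finite E" using fin by (auto simp: D_def E_def)
  ultimately have "card {C. splitting a b S C \<or> splitting b a S C} = card D + card E"
    by (simp add: card_image card_Un_disjoint)
  also have "\<dots> = 2 * (a + 1) * (a + b + 1 - a)"
    unfolding D_def E_def by (rule card_circles_with_side_size[OF assms(1) cardS]) simp
  finally show ?thesis by simp
qed

end
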